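(* Let $R(z)$ be a $p\times p$ self-adjoint rational matrix function with a matrix fraction $R(z)=Q(z)P(z)^{-1}$, $z\notin\sigma(P)$, where $Q(z)$ is a $p\times p$ matrix polynomial and $P(z)$ is a monic $p\times p$ matrix polynomial with $\deg P\ge1$. Then $R(z)$ is a matrix-valued Herglotz-Nevanlinna function if and only if $R(z)$ can be represented in the form $$R(z)=Az+B+\sum_{j=1}^r\frac{E_j}{\lambda_j-z},\quad z\notin\{\lambda_j\}_{j=1}^r,$$ where $A\succeq0$, $B=B^*$, $E_j\succeq0$ and $\{\lambda_j\}_{j=1}^r\subseteq\sigma(P)\cap\mathbb R$. In this case, if $\sigma(P)\subseteq\mathbb R$, then $\{\lambda_j\}_{j=1}^r$ coincides with $\sigma(P)$, where some of the $E_j$ are allowed to be $0_p$ (that is, the representation holds with $\lambda_1,\dots,\lambda_r$ being the distinct elements of $\sigma(P)$).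
   Context: Here $p\in\mathbb N$; $A^*$ is the conjugate transpose; $\succeq0$ means self-adjoint and nonnegative definite; $0_p,I_p$ are the zero and identity $p\times p$ matrices. A $p\times p$ matrix polynomial $F(z)=\sum_{k=0}^n A_kz^{n-k}$ with $A_k\in\mathbb C^{p\times p}$, $A_0\neq0_p$, has degree $n$ and is monic if $A_0=I_p$; if $\det F\not\equiv0$, $\sigma(F)=\{\lambda\in\mathbb C:\det F(\lambda)=0\}$. A rational matrix function is a matrix function whose entries are complex rational functions. It is self-adjoint if $R(z)=R(\bar z)^*$ for all $z\in\mathbb C$ except the poles of its entries. $R$ is a matrix-valued Herglotz-Nevanlinna function if it is holomorphic on the open upper half-plane $\mathbb C_+$ and $\frac1{2\mathrm i}(R(z)-R(z)^* )\succeq0$ for all $z\in\mathbb C_+$. *)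

theory Defs
  imports "HOL-Complex_Analysis.Complex_Analysis" "HOL-Library.Nonpos_Ints"
begin

text \<open>
  A \<open>p \<times> p\<close> matrix is an element of \<^typ>\<open>complex ^ 'p ^ 'p\<close>, with \<open>p\<close> being \<open>CARD('p)\<close>. HOL-Analysis
  provides neither the conjugate transpose nor multiplication of a matrix by a complex scalar.
\<close>

definition conj_transpose :: "complex ^ 'p ^ 'p \<Rightarrow> complex ^ 'p ^ 'p"
  where "conj_transpose A = (\<chi> i j. cnj (A $ j $ i))"

definition mscale :: "complex \<Rightarrow> complex ^ 'p ^ 'p \<Rightarrow> complex ^ 'p ^ 'p"  (infixr \<open>*\<^sub>C\<close> 75)
  where "c *\<^sub>C A = (\<chi> i j. c * A $ i $ j)"

definition psd :: "complex ^ 'p ^ 'p \<Rightarrow> bool"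
  where "psd A \<longleftrightarrow> conj_transpose A = A \<and>
           (\<forall>x :: complex ^ 'p. (\<Sum>i\<in>UNIV. cnj (x $ i) * (A *v x) $ i) \<in> \<real>\<^sub>\<ge>\<^sub>0)"

text \<open>
  A matrix polynomial is an element of \<^typ>\<open>(complex ^ 'p ^ 'p) poly\<close>: a finitely supported sequence
  of matrix coefficients, with the library's \<^const>\<open>coeff\<close>, \<^const>\<open>degree\<close> and \<^const>\<open>lead_coeff\<close>.
  The library's \<^const>\<open>poly\<close> is not the right evaluation map, since its argument would be a matrix
  and the class product on vectors is componentwise.
\<close>

definition mpoly_eval :: "(complex ^ 'p ^ 'p) poly \<Rightarrow> complex \<Rightarrow> complex ^ 'p ^ 'p"
  where "mpoly_eval F z = (\<Sum>k\<le>degree F. z ^ k *\<^sub>C coeff F k)"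

text \<open>The constant \<open>1\<close> of the vector type is the all-ones matrix; the identity matrix is \<^term>\<open>mat 1\<close>.\<close>

definition monic_mpoly :: "(complex ^ 'p ^ 'p) poly \<Rightarrow> bool"
  where "monic_mpoly F \<longleftrightarrow> lead_coeff F = mat 1"

definition mpoly_spectrum :: "(complex ^ 'p ^ 'p) poly \<Rightarrow> complex set"
  where "mpoly_spectrum F = {z. det (mpoly_eval F z) = 0}"

text \<open>
  A rational function is given by a total function whose values at its finitely many poles are
  arbitrary. Since the fraction is in lowest terms, the values at removable singularities are
  the continuous ones.
\<close>

definition rational_fun :: "(complex \<Rightarrow> complex) \<Rightarrow> bool"
  where "rational_fun f \<longleftrightarrow>
           (\<exists>n d :: complex poly. d \<noteq> 0 \<and> coprime n d \<and>
              (\<forall>z. poly d z \<noteq> 0 \<longrightarrow> f z = poly n z / poly d z))"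

definition rational_matrix_fun :: "(complex \<Rightarrow> complex ^ 'p ^ 'p) \<Rightarrow> bool"
  where "rational_matrix_fun R \<longleftrightarrow> (\<forall>i j. rational_fun (\<lambda>z. R z $ i $ j))"

definition entry_poles :: "(complex \<Rightarrow> complex ^ 'p ^ 'p) \<Rightarrow> complex set"
  where "entry_poles R = {z. \<exists>i j. is_pole (\<lambda>w. R w $ i $ j) z}"

definition self_adjoint_fun :: "(complex \<Rightarrow> complex ^ 'p ^ 'p) \<Rightarrow> bool"
  where "self_adjoint_fun R \<longleftrightarrow>
           (\<forall>z. z \<notin> entry_poles R \<longrightarrow> R z = conj_transpose (R (cnj z)))"

definition herglotz_nevanlinna :: "(complex \<Rightarrow> complex ^ 'p ^ 'p) \<Rightarrow> bool"
  where "herglotz_nevanlinna R \<longleftrightarrow>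
           (\<forall>i j. (\<lambda>z. R z $ i $ j) holomorphic_on {z. Im z > 0}) \<and>
           (\<forall>z. Im z > 0 \<longrightarrow> psd ((1 / (2 * \<i>)) *\<^sub>C (R z - conj_transpose (R z))))"

definition has_herglotz_rep ::
    "(complex \<Rightarrow> complex ^ 'p ^ 'p) \<Rightarrow> complex ^ 'p ^ 'p \<Rightarrow> complex ^ 'p ^ 'p \<Rightarrow>
     nat \<Rightarrow> (nat \<Rightarrow> complex ^ 'p ^ 'p) \<Rightarrow> (nat \<Rightarrow> complex) \<Rightarrow> bool"
  where "has_herglotz_rep R A B r E \<mu> \<longleftrightarrow>
           psd A \<and> conj_transpose B = B \<and> (\<forall>j\<in>{1..r}. psd (E j)) \<and>
           (\<forall>z. z \<notin> \<mu> ` {1..r} \<longrightarrow>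
              R z = z *\<^sub>C A + B + (\<Sum>j=1..r. (1 / (\<mu> j - z)) *\<^sub>C E j))"

end

theory Submission
  imports
    Defs
    "HOL-Computational_Algebra.Field_as_Ring"
    "HOL-Computational_Algebra.Fundamental_Theorem_Algebra"
    "HOL-Computational_Algebra.Polynomial_Factorial"
begin

text \<open>
  For \<open>x \<in> \<complex>\<^sup>p\<close> the scalar rational function \<open>f z = x\<^sup>* R(z) x\<close> maps the upper half plane to its
  closure. If \<open>f\<close> behaves like \<open>c u\<^sup>m\<close> with \<open>m \<ge> 2\<close>, where \<open>u\<close> is \<open>z\<close> near infinity or \<open>1 / (s - z)\<close> near a
  real pole \<open>s\<close>, then \<open>c u\<^sup>m\<close> takes all arguments, so \<open>c = 0\<close>: the poles are simple and the growth is
  at most linear. Hence \<open>f\<close> has a partial fraction expansion of the required shape, and polarization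
  gives one for every entry of \<open>R\<close>. The case \<open>m = 1\<close> of the same limits shows that \<open>x\<^sup>* A x\<close> and
  \<open>x\<^sup>* E\<^sub>j x\<close> are nonnegative. There are no poles in the upper half plane by assumption, none in the
  lower one by symmetry, and none outside \<open>\<sigma>(P)\<close> by Cramer's rule.
\<close>

unbundle no fps_syntax

subsection \<open>Quadratic forms of complex matrices\<close>

definition qform :: "complex ^ 'p ^ 'p \<Rightarrow> complex ^ 'p \<Rightarrow> complex"
  where "qform M x = (\<Sum>i\<in>UNIV. cnj (x $ i) * (M *v x) $ i)"

lemma qform_add: "qform (M + N) x = qform M x + qform N x"
  by (simp add: qform_def matrix_vector_mult_add_rdistrib algebra_simps sum.distrib)

lemma mscale_vector_mult: "(c *\<^sub>C M) *v x = c *s (M *v x)"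
  by (simp add: mscale_def matrix_vector_mult_def vec_eq_iff sum_distrib_left mult_ac)

lemma qform_mscale: "qform (c *\<^sub>C M) x = c * qform M x"
  by (simp add: qform_def mscale_vector_mult sum_distrib_left mult_ac)

lemma qform_sum: "qform (\<Sum>i\<in>I. F i) x = (\<Sum>i\<in>I. qform (F i) x)"
proof (induction I rule: infinite_finite_induct)
  case (insert a I)
  then show ?case by (simp add: qform_add)
qed (simp_all add: qform_def)

lemma qform_eq_entries:
  "qform M x = (\<Sum>i\<in>UNIV. \<Sum>j\<in>UNIV. cnj (x $ i) * M $ i $ j * x $ j)"
  by (simp add: qform_def matrix_vector_mult_def sum_distrib_left mult.assoc)

lemma qform_conj_transpose: "qform (conj_transpose M) x = cnj (qform M x)"
proof -
  have "qform (conj_transpose M) x = (\<Sum>i\<in>UNIV. \<Sum>j\<in>UNIV. cnj (x $ i) * cnj (M $ j $ i) * x $ j)"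
    by (simp add: qform_eq_entries conj_transpose_def)
  also have "\<dots> = (\<Sum>j\<in>UNIV. \<Sum>i\<in>UNIV. cnj (x $ i) * cnj (M $ j $ i) * x $ j)"
    by (rule sum.swap)
  also have "\<dots> = cnj (qform M x)"
    by (simp add: qform_eq_entries mult_ac)
  finally show ?thesis .
qed

lemma qform_axis_add_axis:
  "qform M (axis i 1 + axis j c) =
     M $ i $ i + c * M $ i $ j + cnj c * M $ j $ i + cnj c * c * M $ j $ j"
proof -
  have mv: "M *v axis k a = (\<chi> l. M $ l $ k * a)" for k a
    by (simp add: matrix_vector_mult_def axis_def vec_eq_iff if_distrib cong: if_cong)
  have s: "(\<Sum>l\<in>UNIV. cnj (axis k a $ l) * h l) = cnj a * h k" for k a and h :: "'a \<Rightarrow> complex"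
    by (simp add: axis_def if_distrib if_distribR cong: if_cong)
  have "qform M (axis i 1 + axis j c) =
      (\<Sum>l\<in>UNIV. cnj (axis i 1 $ l) * (M $ l $ i + M $ l $ j * c)) +
      (\<Sum>l\<in>UNIV. cnj (axis j c $ l) * (M $ l $ i + M $ l $ j * c))"
    by (simp add: qform_def matrix_vector_right_distrib mv sum.distrib distrib_right)
  then show ?thesis by (simp only: s) (simp add: algebra_simps)
qed

lemma qform_axis: "qform M (axis i 1) = M $ i $ i"
  using qform_axis_add_axis[of M i i 0] by (simp add: axis_def zero_vec_def[symmetric] cong: if_cong)

text \<open>The weights 1 and -i cancel \<open>M $ j $ i\<close> and double
  \<open>M $ i $ j\<close>; the last term removes the diagonal. As the weights do not depend on
  \<open>M\<close>, linear properties of the forms pass to the entries.\<close>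

lemma polarization:
  "M $ i $ j = (qform M (axis i 1 + axis j 1) - \<i> * qform M (axis i 1 + axis j \<i>)
       - (1 - \<i>) * (qform M (axis i 1) + qform M (axis j 1))) / 2"
  by (simp add: qform_axis_add_axis qform_axis algebra_simps)

text \<open>Real values of the form already force self-adjointness: e_i + e_j compares the imaginary
  parts of the two mirrored entries, e_i + i e_j their real parts.\<close>

lemma psd_iff_qform: "psd M \<longleftrightarrow> (\<forall>x. qform M x \<in> \<real>\<^sub>\<ge>\<^sub>0)"
proof
  assume *: "\<forall>x. qform M x \<in> \<real>\<^sub>\<ge>\<^sub>0"
  have r: "Im (qform M x) = 0" for x
    using * by (auto simp: complex_nonneg_Reals_iff)
  have "cnj (M $ j $ i) = M $ i $ j" for i j
    using r[of "axis i 1"] r[of "axis j 1"] r[of "axis i 1 + axis j 1"] r[of "axis i 1 + axis j \<i>"]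
    by (simp add: qform_axis qform_axis_add_axis complex_eq_iff)
  then show "psd M"
    using * by (simp add: psd_def conj_transpose_def qform_def vec_eq_iff)
qed (simp add: psd_def qform_def)

text \<open>Passing to forms turns the positivity in \<open>herglotz_nevanlinna\<close> into a
  condition on scalar functions.\<close>

lemma psd_imaginary_part_iff:
  "psd ((1 / (2 * \<i>)) *\<^sub>C (M - conj_transpose M)) \<longleftrightarrow> (\<forall>x. 0 \<le> Im (qform M x))"
proof -
  have "qform ((1 / (2 * \<i>)) *\<^sub>C (M - conj_transpose M)) x = of_real (Im (qform M x))" for x
  proof -
    have "M - conj_transpose M = M + (-1) *\<^sub>C conj_transpose M"
      by (simp add: mscale_def vec_eq_iff)
    then have "qform (M - conj_transpose M) x = qform M x - cnj (qform M x)"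
      by (simp only: qform_add qform_mscale qform_conj_transpose) simp
    then show ?thesis
      by (simp add: qform_mscale complex_eq_iff)
  qed
  then show ?thesis by (simp add: psd_iff_qform)
qed

section \<open>Sufficiency of the representation\<close>

lemma Im_simple_fraction_nonneg:
  assumes "e \<in> \<real>\<^sub>\<ge>\<^sub>0" "s \<in> \<real>" "Im z \<ge> 0"
  shows "0 \<le> Im (e / (s - z))"
  using assms by (auto simp: complex_nonneg_Reals_iff complex_is_Real_iff Im_divide)

text \<open>Real poles keep the upper half plane clear, which gives holomorphy. In the form, the
  term of \<open>B\<close> is real and those of \<open>A\<close> and \<open>E k\<close> have
  nonnegative imaginary part.\<close>

lemma herglotz_nevanlinna_if_rep:
  assumes rep: "has_herglotz_rep R A B r E \<mu>" and real: "\<mu> ` {1..r} \<subseteq> \<real>"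
  shows "herglotz_nevanlinna R"
proof -
  have ne: "z \<notin> \<mu> ` {1..r}" if "Im z > 0" for z
    using real that by (auto simp: complex_is_Real_iff)
  have A: "psd A" and B: "conj_transpose B = B" and E: "\<And>j. j \<in> {1..r} \<Longrightarrow> psd (E j)"
    and R: "\<And>z. Im z > 0 \<Longrightarrow> R z = z *\<^sub>C A + B + (\<Sum>j=1..r. (1 / (\<mu> j - z)) *\<^sub>C E j)"
    using rep ne by (auto simp: has_herglotz_rep_def)
  have "(\<lambda>z. R z $ i $ j) holomorphic_on {z. Im z > 0}" for i j
  proof (rule holomorphic_transform)
    show "(\<lambda>z. z * A $ i $ j + B $ i $ j + (\<Sum>k=1..r. 1 / (\<mu> k - z) * E k $ i $ j))
        holomorphic_on {z. Im z > 0}"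
      using ne by (intro holomorphic_intros) (force simp: image_iff)
  qed (simp add: R mscale_def)
  moreover have "0 \<le> Im (qform (R z) x)" if z: "Im z > 0" for z x
  proof -
    have "Im (qform B x) = 0"
      using qform_conj_transpose[of B x] by (simp add: B complex_eq_iff)
    moreover have "0 \<le> Im (z * qform A x)"
      using A z by (auto simp: psd_iff_qform complex_nonneg_Reals_iff)
    moreover have "0 \<le> (\<Sum>k=1..r. Im (qform (E k) x / (\<mu> k - z)))"
      using E real z
      by (intro sum_nonneg Im_simple_fraction_nonneg) (auto simp: psd_iff_qform)
    ultimately show ?thesis
      by (simp add: R z qform_add qform_mscale qform_sum)
  qed
  ultimately show ?thesis
    unfolding herglotz_nevanlinna_def psd_imaginary_part_iff by blast
qed

subsection \<open>Scalar rational Nevanlinna functions\<close>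

text \<open>Testing u = k + i gives Re c + k Im c \<ge> 0 for every real k, which forces Im c =
  0.\<close>

lemma nonneg_Reals_if_upper_half_plane:
  assumes "\<And>u. Im u > 0 \<Longrightarrow> 0 \<le> Im (c * u)"
  shows "c \<in> \<real>\<^sub>\<ge>\<^sub>0"
proof -
  have h: "0 \<le> Re c + k * Im c" for k
    using assms[of "Complex k 1"] by (simp add: mult.commute)
  have "Im c = 0"
  proof (rule ccontr)
    assume "Im c \<noteq> 0"
    then show False using h[of "- (Re c + 1) / Im c"] by simp
  qed
  with h[of 0] show ?thesis by (simp add: complex_nonneg_Reals_iff)
qed

text \<open>For \<open>m \<ge> 2\<close> the powers \<open>u ^ m\<close> of points of the closed upper half plane attain every argument.\<close>

lemma zero_if_upper_half_plane_power:
  assumes "m \<ge> 2" and "\<And>u. Im u > 0 \<Longrightarrow> 0 \<le> Im (c * u ^ m)"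
  shows "c = 0"
proof (rule ccontr)
  assume c: "c \<noteq> 0"
  \<comment> \<open>The hypothesis covers only 0 < t < pi; continuity adds the endpoints, and t = 0
    may occur below.\<close>
  have ge: "0 \<le> Im (c * cis t ^ m)" if "t \<in> {0..pi}" for t
  proof (rule continuous_ge_on_closure[where f = "\<lambda>t. Im (c * cis t ^ m)"])
    show "continuous_on (closure {0<..<pi}) (\<lambda>t. Im (c * cis t ^ m))"
      by (intro continuous_intros)
    show "t \<in> closure {0<..<pi}" using that by simp
    show "0 \<le> Im (c * cis t ^ m)" if "t \<in> {0<..<pi}" for t
      using that by (intro assms(2)) (auto simp: sin_gt_zero)
  qed
  \<comment> \<open>With this argument c cis \<phi> = -i |c|, whose imaginary part is negative; m
    \<ge> 2 brings \<phi> / m into [0, pi].\<close>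
  define \<phi> where "\<phi> = Arg2pi (- \<i> / c)"
  have "\<phi> / m \<le> 2 * pi / 2"
    using Arg2pi[of "- \<i> / c"] assms(1) unfolding \<phi>_def by (intro frac_le) auto
  moreover have "0 \<le> \<phi> / m"
    using Arg2pi[of "- \<i> / c"] by (simp add: \<phi>_def)
  ultimately have "0 \<le> Im (c * cis (\<phi> / m) ^ m)"
    by (intro ge) auto
  moreover have "cis (\<phi> / m) ^ m = cis \<phi>"
    using assms(1) by (simp add: Complex.DeMoivre)
  moreover have "cis \<phi> = norm c * (- \<i> / c)"
    using Arg2pi_eq[of "- \<i> / c"] c by (simp add: \<phi>_def cis_conv_exp norm_divide field_simps)
  ultimately show False using c by simp
qed

text \<open>Along the ray z = t u the quotient times u^m equals f(t u) / t^m, and the positive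
  number t^m does not affect the sign of the imaginary part.\<close>

lemma upper_half_plane_limit_at_infinity:
  assumes "\<And>z. Im z > 0 \<Longrightarrow> 0 \<le> Im (f z)"
    and lim: "((\<lambda>z. f z / z ^ m) \<longlongrightarrow> c) at_infinity" and u: "Im u > 0"
  shows "0 \<le> Im (c * u ^ m)"
proof -
  have u0: "u \<noteq> 0" using u by auto
  have "filterlim (\<lambda>t. complex_of_real t * u) at_infinity at_top"
    using tendsto_mult_filterlim_at_infinity[OF tendsto_const u0 filterlim_of_real_at_infinity]
    by (simp add: mult.commute)
  from filterlim_compose[OF lim this]
  have "((\<lambda>t. f (of_real t * u) / (of_real t * u) ^ m * u ^ m) \<longlongrightarrow> c * u ^ m) at_top"
    by (intro tendsto_intros)
  then have "((\<lambda>t. Im (f (of_real t * u) / (of_real t * u) ^ m * u ^ m)) \<longlongrightarrow> Im (c * u ^ m)) at_top"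
    by (rule tendsto_Im)
  moreover have "\<forall>\<^sub>F t in at_top. 0 \<le> Im (f (of_real t * u) / (of_real t * u) ^ m * u ^ m)"
    using eventually_gt_at_top[of 0]
  proof eventually_elim
    case (elim t)
    have "f (of_real t * u) / (of_real t * u) ^ m * u ^ m = f (of_real t * u) / of_real (t ^ m)"
      using u0 by (simp add: power_mult_distrib)
    moreover have "0 \<le> Im (f (of_real t * u))"
      using elim u by (intro assms(1)) simp
    ultimately show ?case using elim by (simp only: Im_divide_of_real) simp
  qed
  ultimately show ?thesis by (intro tendsto_lowerbound) auto
qed

text \<open>The real point \<open>s\<close> is approached along \<open>z = s - t / u\<close>, which lies in the upper half plane with \<open>u\<close>.\<close>

lemma upper_half_plane_limit_at_real:
  assumes "\<And>z. Im z > 0 \<Longrightarrow> 0 \<le> Im (f z)" and s: "s \<in> \<real>"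
    and lim: "((\<lambda>z. (s - z) ^ m * f z) \<longlongrightarrow> c) (at s)" and u: "Im u > 0"
  shows "0 \<le> Im (c * u ^ m)"
proof -
  have u0: "u \<noteq> 0" using u by auto
  define g where "g t = s - complex_of_real t / u" for t
  have "filterlim g (at s) (at_right 0)"
    unfolding g_def using u0
    by (auto simp: filterlim_at eventually_at_filter intro!: tendsto_eq_intros)
  from filterlim_compose[OF lim this]
  have "((\<lambda>t. (s - g t) ^ m * f (g t) * u ^ m) \<longlongrightarrow> c * u ^ m) (at_right 0)"
    by (intro tendsto_intros)
  then have "((\<lambda>t. Im ((s - g t) ^ m * f (g t) * u ^ m)) \<longlongrightarrow> Im (c * u ^ m)) (at_right 0)"
    by (rule tendsto_Im)
  moreover have "\<forall>\<^sub>F t in at_right 0. 0 \<le> Im ((s - g t) ^ m * f (g t) * u ^ m)"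
    using eventually_at_right_less[of 0]
  proof eventually_elim
    case (elim t)
    \<comment> \<open>Here s - g t = t / u, so the factor u^m leaves only the positive number
      t^m.\<close>
    have eq: "(s - g t) ^ m * f (g t) * u ^ m = of_real (t ^ m) * f (g t)"
      using u0 by (simp add: g_def power_divide)
    have "0 < Im (g t)"
    proof -
      have "0 < (Re u)\<^sup>2 + (Im u)\<^sup>2" using u by (simp add: sum_power2_gt_zero_iff)
      then show ?thesis
        using elim u s by (simp add: g_def complex_is_Real_iff Im_divide)
    qed
    then have "0 \<le> Im (f (g t))"
      by (rule assms(1))
    then show ?case unfolding eq using elim by simp
  qed
  ultimately show ?thesis by (intro tendsto_lowerbound) auto
qed

section \<open>Bounds on growth and pole order\<close>

text \<open>A degree excess m \<ge> 2 would make the fraction grow like c z^m, with c the nonzero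
  ratio of the leading coefficients.\<close>

lemma nevanlinna_degree_bound:
  fixes n d :: "complex poly"
  assumes d: "d \<noteq> 0" and im: "\<And>z. Im z > 0 \<Longrightarrow> 0 \<le> Im (poly n z / poly d z)"
  shows "degree n \<le> degree d + 1"
proof (rule ccontr)
  assume *: "\<not> ?thesis"
  define m where "m = degree n - degree d"
  have "((\<lambda>z. (poly n z / z ^ degree n) / (poly d z / z ^ degree d)) \<longlongrightarrow> lead_coeff n / lead_coeff d)
      at_infinity"
    using d by (intro tendsto_divide poly_divide_tendsto_aux) auto
  moreover have "\<forall>\<^sub>F z in at_infinity. (poly n z / z ^ degree n) / (poly d z / z ^ degree d) =
      poly n z / poly d z / z ^ m"
  proof (rule eventually_at_infinityI[of 1])
    fix z :: complex assume "1 \<le> norm z"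
    then have "z \<noteq> 0" by auto
    moreover have "degree n = degree d + m" using * by (simp add: m_def)
    ultimately show "(poly n z / z ^ degree n) / (poly d z / z ^ degree d) = poly n z / poly d z / z ^ m"
      by (simp add: power_add)
  qed
  ultimately have "((\<lambda>z. poly n z / poly d z / z ^ m) \<longlongrightarrow> lead_coeff n / lead_coeff d) at_infinity"
    by (rule Lim_transform_eventually)
  from upper_half_plane_limit_at_infinity[OF im this]
  have "lead_coeff n / lead_coeff d = 0"
    using * by (intro zero_if_upper_half_plane_power[of m]) (auto simp: m_def)
  then show False using d * by auto
qed

text \<open>At a root of order m the fraction times (s - z)^m tends to (-1)^m n(s) / q(s), where q
  is the cofactor of (z - s)^m in d. Coprimality makes this nonzero, so m \<ge> 2 is
  impossible.\<close>

lemma nevanlinna_order_bound: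
  fixes n d :: "complex poly"
  assumes d: "d \<noteq> 0" and "coprime n d" and s: "s \<in> \<real>"
    and im: "\<And>z. Im z > 0 \<Longrightarrow> 0 \<le> Im (poly n z / poly d z)"
  shows "order s d \<le> 1"
proof (rule ccontr)
  assume *: "\<not> ?thesis"
  define m where "m = order s d"
  obtain q where q: "d = [:- s, 1:] ^ m * q" "\<not> [:- s, 1:] dvd q"
    using order_decomp[OF d] unfolding m_def by blast
  have qs: "poly q s \<noteq> 0" using q(2) by (simp add: poly_eq_0_iff_dvd)
  have "poly d s = 0" using * by (auto simp: order_root)
  then have ns: "poly n s \<noteq> 0" using coprime_poly_0[OF \<open>coprime n d\<close>] by blast
  have "((\<lambda>z. (-1) ^ m * poly n z / poly q z) \<longlongrightarrow> (-1) ^ m * poly n s / poly q s) (at s)"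
    using qs by (intro tendsto_intros)
  moreover have "\<forall>\<^sub>F z in at s. (-1) ^ m * poly n z / poly q z = (s - z) ^ m * (poly n z / poly d z)"
  proof (rule eventually_at_topological[THEN iffD2], intro exI[of _ UNIV] conjI ballI impI)
    fix z assume z: "z \<noteq> s"
    have "s - z = (-1) * (z - s)" by simp
    then have "(s - z) ^ m = (-1) ^ m * (z - s) ^ m" by (simp only: power_mult_distrib)
    with z show "(-1) ^ m * poly n z / poly q z = (s - z) ^ m * (poly n z / poly d z)"
      by (simp add: q(1))
  qed auto
  ultimately have "((\<lambda>z. (s - z) ^ m * (poly n z / poly d z)) \<longlongrightarrow> (-1) ^ m * poly n s / poly q s) (at s)"
    by (rule Lim_transform_eventually)
  from upper_half_plane_limit_at_real[OF im s this]
  have "(-1) ^ m * poly n s / poly q s = 0"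
    using * by (intro zero_if_upper_half_plane_power[of m]) (auto simp: m_def)
  then show False using qs ns by simp
qed

section \<open>Partial fractions with simple poles\<close>

text \<open>Induction on the degree of \<open>d\<close>, splitting off one root at a time. The one
  extra degree allowed to \<open>n\<close> survives each step and ends as the linear part.\<close>

lemma simple_partial_fractions:
  fixes n d :: "complex poly"
  assumes "d \<noteq> 0" "\<And>s. order s d \<le> 1" "degree n \<le> degree d + 1"
  shows "\<exists>a b e. \<forall>z. poly d z \<noteq> 0 \<longrightarrow>
           poly n z / poly d z = a * z + b + (\<Sum>s | poly d s = 0. e s / (s - z))"
  using assms
proof (induction "degree d" arbitrary: d n)
  case 0
  then obtain k where k: "d = [:k:]" by (metis degree_eq_zeroE)
  have "degree n \<le> 1" using 0 by simp
  then have "n = [:coeff n 0, coeff n 1:]"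
    by (intro poly_eqI) (auto simp: coeff_pCons coeff_eq_0 split: nat.splits)
  then have "poly n z = poly [:coeff n 0, coeff n 1:] z" for z
    by (rule arg_cong)
  then have "poly d z \<noteq> 0 \<longrightarrow> poly n z / poly d z = coeff n 1 / k * z + coeff n 0 / k + 0" for z
    by (simp add: k add_divide_distrib mult.commute)
  moreover have "{s. poly d s = 0} = {}" using k 0 by auto
  ultimately show ?case by (metis sum.empty)
next
  case (Suc l)
  then have "\<not> constant (poly d)" by (simp add: constant_degree)
  then obtain s where s: "poly d s = 0" using fundamental_theorem_of_algebra by blast
  then obtain q where q: "d = [:- s, 1:] * q" by (metis dvdE poly_eq_0_iff_dvd)
  have q0: "q \<noteq> 0" using q Suc.prems(1) by auto
  have ord: "order t d = order t [:- s, 1:] + order t q" for t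
    using order_mult[of "[:- s, 1:]" q t] q Suc.prems(1) by simp
  have "order s [:- s, 1:] = 1" using order_power_n_n[of s 1] by simp
  then have "order s q = 0" using ord[of s] Suc.prems(2)[of s] by simp
  then have qs: "poly q s \<noteq> 0" using q0 by (simp add: order_root)
  have dq: "degree d = degree q + 1" unfolding q using q0 by (subst degree_mult_eq) auto
  \<comment> \<open>The residue at s, where q(s) is nonzero because the root is simple: this
    multiple of q makes n - c q divisible by z - s.\<close>
  define c where "c = poly n s / poly q s"
  have "poly (n - smult c q) s = 0" using qs by (simp add: c_def)
  then obtain n' where n': "n - smult c q = [:- s, 1:] * n'" by (metis dvdE poly_eq_0_iff_dvd)
  have "degree n' \<le> degree q + 1"
  proof (cases "n' = 0")
    case False
    then have "degree n' + 1 = degree (n - smult c q)" unfolding n' by (subst degree_mult_eq) auto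
    also have "\<dots> \<le> degree q + 2"
      using Suc.prems(3) dq by (intro degree_diff_le) (auto intro: order.trans[OF degree_smult_le])
    finally show ?thesis by simp
  qed simp
  moreover have "order t q \<le> 1" for t using ord[of t] Suc.prems(2)[of t] by simp
  moreover have "l = degree q" using Suc.hyps(2) dq by simp
  ultimately obtain a b e where IH: "\<And>z. poly q z \<noteq> 0 \<Longrightarrow>
      poly n' z / poly q z = a * z + b + (\<Sum>t | poly q t = 0. e t / (t - z))"
    using Suc.hyps(1)[of q n'] q0 by blast
  \<comment> \<open>The sign comes from c / (z - s) = - c / (s - z). The sum over the roots of q is
    unaffected, as s is not one of them.\<close>
  define e' where "e' = e(s := - c)"
  have roots: "{t. poly d t = 0} = insert s {t. poly q t = 0}" by (auto simp: q)
  have "poly n z / poly d z = a * z + b + (\<Sum>t | poly d t = 0. e' t / (t - z))"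
    if z: "poly d z \<noteq> 0" for z
  proof -
    have zs: "z \<noteq> s" and qz: "poly q z \<noteq> 0" using z by (auto simp: q)
    have "poly (n - smult c q) z = (z - s) * poly n' z" by (simp add: n' algebra_simps)
    then have "poly n z = c * poly q z + (z - s) * poly n' z" by (simp add: algebra_simps)
    moreover have "poly d z = (z - s) * poly q z" by (simp add: q algebra_simps)
    ultimately have "poly n z / poly d z = c / (z - s) + poly n' z / poly q z"
      using zs qz by (simp add: add_divide_distrib)
    also have "c / (z - s) = - c / (s - z)"
      using minus_divide_divide[of c "z - s"] by simp
    finally have "poly n z / poly d z = - c / (s - z) + poly n' z / poly q z" .
    also have "\<dots> = a * z + b + (- c / (s - z) + (\<Sum>t | poly q t = 0. e' t / (t - z)))"
    proof -
      have "(\<Sum>t | poly q t = 0. e t / (t - z)) = (\<Sum>t | poly q t = 0. e' t / (t - z))"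
        using qs by (intro sum.cong) (auto simp: e'_def)
      then show ?thesis by (simp add: IH qz)
    qed
    also have "\<dots> = a * z + b + (\<Sum>t | poly d t = 0. e' t / (t - z))"
      using qs q0 by (simp add: roots poly_roots_finite e'_def)
    finally show ?thesis .
  qed
  then show ?case by blast
qed

text \<open>All functions share the set \<open>S\<close> and coefficients may vanish, so the class
  is closed under linear combinations, as \<open>polarization\<close> requires.\<close>

definition simple_fraction_on :: "complex set \<Rightarrow> (complex \<Rightarrow> complex) \<Rightarrow> bool"
  where "simple_fraction_on S f \<longleftrightarrow>
    (\<exists>a b e. \<forall>z. z \<notin> S \<longrightarrow> f z = a * z + b + (\<Sum>s\<in>S. e s / (s - z)))"

lemma simple_fraction_onI:
  "(\<And>z. z \<notin> S \<Longrightarrow> f z = a * z + b + (\<Sum>s\<in>S. e s / (s - z))) \<Longrightarrow> simple_fraction_on S f"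
  unfolding simple_fraction_on_def by blast

lemma simple_fraction_on_add:
  assumes "simple_fraction_on S f" "simple_fraction_on S g"
  shows "simple_fraction_on S (\<lambda>z. f z + g z)"
proof -
  from assms obtain a b e a' b' e' where
    "\<And>z. z \<notin> S \<Longrightarrow> f z = a * z + b + (\<Sum>s\<in>S. e s / (s - z))"
    "\<And>z. z \<notin> S \<Longrightarrow> g z = a' * z + b' + (\<Sum>s\<in>S. e' s / (s - z))"
    unfolding simple_fraction_on_def by blast
  then have "f z + g z = (a + a') * z + (b + b') + (\<Sum>s\<in>S. (e s + e' s) / (s - z))" if "z \<notin> S" for z
    using that by (simp add: distrib_right add_divide_distrib sum.distrib)
  then show ?thesis by (rule simple_fraction_onI)
qed

lemma simple_fraction_on_cmult:
  assumes "simple_fraction_on S f"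
  shows "simple_fraction_on S (\<lambda>z. k * f z)"
proof -
  from assms obtain a b e where
    "\<And>z. z \<notin> S \<Longrightarrow> f z = a * z + b + (\<Sum>s\<in>S. e s / (s - z))"
    unfolding simple_fraction_on_def by blast
  then have "k * f z = (k * a) * z + k * b + (\<Sum>s\<in>S. (k * e s) / (s - z))" if "z \<notin> S" for z
    using that by (simp add: distrib_left sum_distrib_left)
  then show ?thesis by (rule simple_fraction_onI)
qed

text \<open>The order bound concerns reduced fractions, so the common divisor is cancelled first.
  Points of \<open>S\<close> that are not roots of the reduced denominator receive coefficient
  0.\<close>

lemma nevanlinna_simple_fraction_on:
  fixes n d :: "complex poly"
  assumes d: "d \<noteq> 0" and S: "finite S" "S \<subseteq> \<real>" "{z. poly d z = 0} \<subseteq> S"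
    and f: "\<And>z. z \<notin> S \<Longrightarrow> f z = poly n z / poly d z"
    and im: "\<And>z. Im z > 0 \<Longrightarrow> 0 \<le> Im (f z)"
  shows "simple_fraction_on S f"
proof -
  have "gcd n d \<noteq> 0" using d by simp
  then obtain n' d' where nd: "n = n' * gcd n d" "d = d' * gcd n d" and cop: "coprime n' d'"
    using gcd_coprime_exists[of n d] by blast
  have d': "d' \<noteq> 0" using nd(2) d by auto
  have roots: "{z. poly d' z = 0} \<subseteq> S"
  proof -
    have "poly d z = poly d' z * poly (gcd n d) z" for z
      using arg_cong[OF nd(2), of "\<lambda>p. poly p z"] by (simp only: poly_mult)
    then show ?thesis using S(3) by auto
  qed
  have f': "f z = poly n' z / poly d' z" if "z \<notin> S" for z
  proof -
    have "poly d z = poly d' z * poly (gcd n d) z" "poly n z = poly n' z * poly (gcd n d) z"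
      using arg_cong[OF nd(2), of "\<lambda>p. poly p z"] arg_cong[OF nd(1), of "\<lambda>p. poly p z"]
      by (simp_all only: poly_mult)
    moreover have "poly d z \<noteq> 0" using that S(3) by auto
    ultimately show ?thesis using f[OF that] by simp
  qed
  have im': "0 \<le> Im (poly n' z / poly d' z)" if "Im z > 0" for z
    using im[OF that] f'[of z] S(2) that by (force simp: complex_is_Real_iff)
  have "order s d' \<le> 1" for s
  proof (cases "poly d' s = 0")
    case True
    then show ?thesis
      using roots S(2) im' by (intro nevanlinna_order_bound[OF d' cop]) auto
  qed (simp add: order_0I)
  then obtain a b e where abe: "\<And>z. poly d' z \<noteq> 0 \<Longrightarrow>
      poly n' z / poly d' z = a * z + b + (\<Sum>s | poly d' s = 0. e s / (s - z))"
    using simple_partial_fractions[OF d' _ nevanlinna_degree_bound[OF d' im']] by blast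
  define e' where "e' s = (if poly d' s = 0 then e s else 0)" for s
  have "f z = a * z + b + (\<Sum>s\<in>S. e' s / (s - z))" if z: "z \<notin> S" for z
  proof -
    have "(\<Sum>s | poly d' s = 0. e s / (s - z)) = (\<Sum>s\<in>S. e' s / (s - z))"
      using roots S(1) by (intro sum.mono_neutral_cong_left) (auto simp: e'_def)
    moreover have "poly d' z \<noteq> 0" using z roots by auto
    ultimately show ?thesis by (simp add: f' z abe)
  qed
  then show ?thesis by (rule simple_fraction_onI)
qed

text \<open>The coefficient a is the limit of f(z) / z at infinity and \<open>e s\<close> that of (s
  - z) f(z) at s; both fall under the case m = 1 of the half-plane limits.\<close>

lemma nevanlinna_simple_fraction_coeffs:
  assumes S: "finite S" "S \<subseteq> \<real>"
    and f: "\<And>z. z \<notin> S \<Longrightarrow> f z = a * z + b + (\<Sum>s\<in>S. e s / (s - z))"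
    and im: "\<And>z. Im z > 0 \<Longrightarrow> 0 \<le> Im (f z)"
  shows "a \<in> \<real>\<^sub>\<ge>\<^sub>0" and "s \<in> S \<Longrightarrow> e s \<in> \<real>\<^sub>\<ge>\<^sub>0"
proof -
  define g where "g z = a * z + b + (\<Sum>s\<in>S. e s / (s - z))" for z
  have im: "0 \<le> Im (g z)" if "Im z > 0" for z
    using im[OF that] f[of z] S(2) that by (force simp: complex_is_Real_iff g_def)
  show "a \<in> \<real>\<^sub>\<ge>\<^sub>0"
  proof (rule nonneg_Reals_if_upper_half_plane)
    have "((\<lambda>z. a + (b / z + (\<Sum>s\<in>S. e s / (s - z)) / z)) \<longlongrightarrow> a + (0 + 0)) at_infinity"
    proof (intro tendsto_intros)
      show "((\<lambda>z. b / z) \<longlongrightarrow> 0) at_infinity"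
        by (intro tendsto_divide_0[OF tendsto_const] filterlim_ident)
      have "((\<lambda>z. \<Sum>s\<in>S. e s / (s - z)) \<longlongrightarrow> (\<Sum>s\<in>S. 0)) at_infinity"
      proof (intro tendsto_sum tendsto_divide_0[OF tendsto_const])
        fix s :: complex
        have "filterlim (\<lambda>z. s + (- z)) at_infinity at_infinity"
          by (intro tendsto_add_filterlim_at_infinity[OF tendsto_const])
             (simp add: filterlim_at_infinity_conv_norm_at_top filterlim_norm_at_top)
        then show "filterlim (\<lambda>z. s - z) at_infinity at_infinity" by simp
      qed
      then show "((\<lambda>z. (\<Sum>s\<in>S. e s / (s - z)) / z) \<longlongrightarrow> 0) at_infinity"
        by (intro tendsto_divide_0 filterlim_ident)
    qed
    moreover have "\<forall>\<^sub>F z in at_infinity. a + (b / z + (\<Sum>s\<in>S. e s / (s - z)) / z) = g z / z ^ 1"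
      by (rule eventually_at_infinityI[of 1]) (auto simp: g_def add_divide_distrib)
    ultimately have lim: "((\<lambda>z. g z / z ^ 1) \<longlongrightarrow> a) at_infinity"
      using Lim_transform_eventually by fastforce
    show "0 \<le> Im (a * u)" if "Im u > 0" for u
      using upper_half_plane_limit_at_infinity[OF im lim that] by simp
  qed
  assume s: "s \<in> S"
  show "e s \<in> \<real>\<^sub>\<ge>\<^sub>0"
  proof (rule nonneg_Reals_if_upper_half_plane)
    \<comment> \<open>The product (s - z) g(z) with the term of s cancelled beforehand, hence
      continuous at s.\<close>
    define h where "h z = (s - z) * (a * z + b + (\<Sum>t\<in>S - {s}. e t / (t - z))) + e s" for z
    have "isCont h s"
      unfolding h_def by (intro continuous_intros) auto
    then have "(h \<longlongrightarrow> e s) (at s)" by (simp add: isCont_def h_def)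
    moreover have "h z = (s - z) ^ 1 * g z" if "z \<noteq> s" for z
    proof -
      have "g z = a * z + b + (\<Sum>t\<in>S - {s}. e t / (t - z)) + e s / (s - z)"
        using S(1) s by (simp add: g_def sum.remove)
      then show ?thesis using that by (simp add: h_def distrib_left)
    qed
    then have "\<forall>\<^sub>F z in at s. h z = (s - z) ^ 1 * g z"
      by (simp add: eventually_at_filter)
    ultimately have lim: "((\<lambda>z. (s - z) ^ 1 * g z) \<longlongrightarrow> e s) (at s)"
      by (rule Lim_transform_eventually)
    show "0 \<le> Im (e s * u)" if "Im u > 0" for u
      using upper_half_plane_limit_at_real[OF im _ lim that] s S(2) by auto
  qed
qed

subsection \<open>Matrix-valued functions\<close>

lemma conj_transpose_add: "conj_transpose (M + N) = conj_transpose M + conj_transpose N"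
  by (simp add: conj_transpose_def vec_eq_iff)

lemma conj_transpose_mscale: "conj_transpose (c *\<^sub>C M) = cnj c *\<^sub>C conj_transpose M"
  by (simp add: conj_transpose_def mscale_def vec_eq_iff)

lemma conj_transpose_sum: "conj_transpose (\<Sum>i\<in>I. F i) = (\<Sum>i\<in>I. conj_transpose (F i))"
  by (simp add: conj_transpose_def vec_eq_iff)

text \<open>Necessity, once all roots of the denominators are known to lie in a finite real set. The
  expansion is found for the forms and carried over to the entries.\<close>

lemma rational_nevanlinna_herglotz_rep:
  fixes R :: "complex \<Rightarrow> complex ^ 'p ^ 'p" and n d :: "'p \<Rightarrow> 'p \<Rightarrow> complex poly"
  assumes S: "finite S" "S \<subseteq> \<real>"
    and d: "\<And>i j. d i j \<noteq> 0" "\<And>i j z. poly (d i j) z = 0 \<Longrightarrow> z \<in> S"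
    and R: "\<And>i j z. z \<notin> S \<Longrightarrow> R z $ i $ j = poly (n i j) z / poly (d i j) z"
    and im: "\<And>z x. Im z > 0 \<Longrightarrow> 0 \<le> Im (qform (R z) x)"
    and sa: "\<And>z. z \<notin> S \<Longrightarrow> R z = conj_transpose (R (cnj z))"
  obtains A B r E \<mu> where "has_herglotz_rep R A B r E \<mu>" "bij_betw \<mu> {1..r} S"
proof -
  \<comment> \<open>A common denominator makes each form a single fraction; its roots are roots of
    some \<open>d i j\<close>, so they stay in \<open>S\<close>.\<close>
  define D where "D = (\<Prod>(i, j)\<in>UNIV. d i j)"
  define N where "N i j = n i j * (D div d i j)" for i j
  have D0: "D \<noteq> 0" using d(1) by (auto simp: D_def)
  have Droots: "{z. poly D z = 0} \<subseteq> S" using d(2) by (auto simp: D_def poly_prod)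
  have "d i j dvd D" for i j
    using dvd_prodI[of UNIV "(i, j)" "\<lambda>(i, j). d i j"] by (simp add: D_def)
  then have DN: "poly D z = poly (d i j) z * poly (D div d i j) z" for i j z
    by (metis dvd_mult_div_cancel poly_mult)
  have RN: "R z $ i $ j = poly (N i j) z / poly D z" if "z \<notin> S" for z i j
  proof -
    have "poly D z \<noteq> 0" using that Droots by auto
    then show ?thesis using that by (simp add: R N_def DN[of z i j])
  qed
  have qf: "simple_fraction_on S (\<lambda>z. qform (R z) x)" for x
  proof (rule nevanlinna_simple_fraction_on[OF D0 S Droots])
    show "qform (R z) x =
        poly (\<Sum>i\<in>UNIV. \<Sum>j\<in>UNIV. smult (cnj (x $ i) * x $ j) (N i j)) z / poly D z" if "z \<notin> S" for z
      using that by (simp add: qform_eq_entries RN poly_sum sum_divide_distrib mult_ac)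
  qed (use im in auto)
  have "simple_fraction_on S (\<lambda>z. R z $ i $ j)" for i j
  proof -
    have eq: "R z $ i $ j = 1 / 2 * qform (R z) (axis i 1 + axis j 1)
        + ((- \<i> / 2) * qform (R z) (axis i 1 + axis j \<i>)
        + (- (1 - \<i>) / 2) * (qform (R z) (axis i 1) + qform (R z) (axis j 1)))" for z
      unfolding polarization[of "R z" i j] by (simp add: field_simps)
    show ?thesis
      unfolding eq by (intro simple_fraction_on_add simple_fraction_on_cmult qf)
  qed
  then have "\<forall>i j. \<exists>a b e. \<forall>z. z \<notin> S \<longrightarrow> R z $ i $ j = a * z + b + (\<Sum>s\<in>S. e s / (s - z))"
    unfolding simple_fraction_on_def by blast
  then obtain a b e where abe: "\<And>i j z. z \<notin> S \<Longrightarrow>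
      R z $ i $ j = a i j * z + b i j + (\<Sum>s\<in>S. e i j s / (s - z))"
    unfolding choice_iff by blast
  define A :: "complex ^ 'p ^ 'p" where "A = (\<chi> i j. a i j)"
  define B :: "complex ^ 'p ^ 'p" where "B = (\<chi> i j. b i j)"
  define E :: "complex \<Rightarrow> complex ^ 'p ^ 'p" where "E s = (\<chi> i j. e i j s)" for s
  have rep: "R z = z *\<^sub>C A + B + (\<Sum>s\<in>S. (1 / (s - z)) *\<^sub>C E s)" if "z \<notin> S" for z
    using that by (simp add: vec_eq_iff abe A_def B_def E_def mscale_def mult.commute)
  have qrep: "qform (R z) x = qform A x * z + qform B x + (\<Sum>s\<in>S. qform (E s) x / (s - z))"
    if "z \<notin> S" for z x
    using that by (simp add: rep qform_add qform_mscale qform_sum mult.commute)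
  have A: "psd A" and E: "\<And>s. s \<in> S \<Longrightarrow> psd (E s)"
    using nevanlinna_simple_fraction_coeffs[OF S qrep im] by (auto simp: psd_iff_qform)
  \<comment> \<open>R(i) is compared with the adjoint of R(-i): since \<open>A\<close> and every
    \<open>E s\<close> are self-adjoint and \<open>S\<close> is real, all terms agree except
    \<open>B\<close> and its adjoint.\<close>
  have B: "conj_transpose B = B"
  proof -
    have notin: "\<i> \<notin> S" "- \<i> \<notin> S" using S(2) by (auto simp: complex_is_Real_iff)
    have "(\<Sum>s\<in>S. cnj (1 / (s - - \<i>)) *\<^sub>C conj_transpose (E s)) = (\<Sum>s\<in>S. (1 / (s - \<i>)) *\<^sub>C E s)"
    proof (rule sum.cong)
      fix s assume s: "s \<in> S"
      then have "cnj s = s" using S(2) by (auto simp: Reals_cnj_iff)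
      then show "cnj (1 / (s - - \<i>)) *\<^sub>C conj_transpose (E s) = (1 / (s - \<i>)) *\<^sub>C E s"
        using E[OF s] by (simp add: psd_def)
    qed simp
    then have "conj_transpose (R (cnj \<i>)) = \<i> *\<^sub>C A + conj_transpose B + (\<Sum>s\<in>S. (1 / (s - \<i>)) *\<^sub>C E s)"
      using A rep[OF notin(2)]
      by (simp add: conj_transpose_add conj_transpose_mscale conj_transpose_sum psd_def)
    then show ?thesis
      using sa[OF notin(1)] rep[OF notin(1)] by simp
  qed
  \<comment> \<open>Every point of \<open>S\<close> gets an index, even where \<open>E\<close>
    vanishes, so the enumeration is a bijection onto \<open>S\<close>.\<close>
  obtain h where h: "bij_betw h {1..card S} S"
    using ex_bij_betw_nat_finite_1[OF S(1)] by blast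
  have "has_herglotz_rep R A B (card S) (E \<circ> h) h"
    unfolding has_herglotz_rep_def
  proof (intro conjI ballI allI impI A B)
    show "psd ((E \<circ> h) j)" if "j \<in> {1..card S}" for j
      using E bij_betwE[OF h] that by auto
    fix z assume "z \<notin> h ` {1..card S}"
    then have "z \<notin> S" using h by (simp add: bij_betw_def)
    then show "R z = z *\<^sub>C A + B + (\<Sum>j=1..card S. (1 / (h j - z)) *\<^sub>C (E \<circ> h) j)"
      using sum.reindex_bij_betw[OF h, of "\<lambda>s. (1 / (s - z)) *\<^sub>C E s"] by (simp add: rep)
  qed
  with h show thesis using that by blast
qed

subsection \<open>Matrix polynomials and poles of matrix fractions\<close>

text \<open>Scalar entries make the limits and the root count of \<open>poly\<close> available for
  matrix polynomials.\<close>

definition mpoly_entry :: "(complex ^ 'p ^ 'p) poly \<Rightarrow> 'p \<Rightarrow> 'p \<Rightarrow> complex poly"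
  where "mpoly_entry F i j = (\<Sum>k\<le>degree F. monom (coeff F k $ i $ j) k)"

lemma poly_mpoly_entry: "poly (mpoly_entry F i j) z = mpoly_eval F z $ i $ j"
  by (simp add: mpoly_entry_def mpoly_eval_def mscale_def poly_sum poly_monom mult.commute)

lemma coeff_mpoly_entry: "coeff (mpoly_entry F i j) k = coeff F k $ i $ j"
  by (simp add: mpoly_entry_def coeff_sum coeff_eq_0)

lemma poly_det: "poly (det M) z = det (\<chi> i j. poly (M $ i $ j) z)"
  by (simp add: det_def poly_sum poly_prod)

lemma tendsto_det:
  fixes M :: "'a \<Rightarrow> complex ^ 'p ^ 'p"
  assumes "\<And>i j. ((\<lambda>z. M z $ i $ j) \<longlongrightarrow> L $ i $ j) F"
  shows "((\<lambda>z. det (M z)) \<longlongrightarrow> det L) F"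
  unfolding det_def by (intro tendsto_intros assms)

lemma poly_div_power_tendsto_coeff:
  fixes p :: "'a :: real_normed_field poly"
  assumes "degree p \<le> n"
  shows "((\<lambda>z. poly p z / z ^ n) \<longlongrightarrow> coeff p n) at_infinity"
proof (cases "degree p = n")
  case True
  then show ?thesis using poly_divide_tendsto_aux[of p] by simp
next
  case False
  then have "degree p < degree (monom (1 :: 'a) n)" using assms by (simp add: degree_monom_eq)
  from poly_divide_tendsto_0_at_infinity[OF this] show ?thesis
    using False assms by (simp add: poly_monom coeff_eq_0)
qed

text \<open>The determinant is a polynomial in z. It is not zero: after division of every row by
  z^(deg P) the matrix tends to the identity, so its determinant tends to 1.\<close>

lemma finite_mpoly_spectrum:
  assumes "monic_mpoly P"
  shows "finite (mpoly_spectrum P)"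
proof -
  define D where "D = det (\<chi> i j. mpoly_entry P i j)"
  have D: "poly D z = det (mpoly_eval P z)" for z
    by (simp add: D_def poly_det poly_mpoly_entry)
  have "D \<noteq> 0"
  proof
    assume D0: "D = 0"
    define M where "M z = (\<chi> i. (1 / z ^ degree P) *s mpoly_eval P z $ i)" for z
    have "((\<lambda>z. M z $ i $ j) \<longlongrightarrow> mat 1 $ i $ j) at_infinity" for i j
    proof -
      have "degree (mpoly_entry P i j) \<le> degree P"
        by (rule degree_le) (simp add: coeff_mpoly_entry coeff_eq_0)
      from poly_div_power_tendsto_coeff[OF this] show ?thesis
        using assms by (simp add: M_def poly_mpoly_entry coeff_mpoly_entry monic_mpoly_def)
    qed
    then have "((\<lambda>z. det (M z)) \<longlongrightarrow> det (mat 1 :: complex ^ 'a ^ 'a)) at_infinity"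
      by (rule tendsto_det)
    moreover have "det (M z) = 0" for z
      unfolding M_def det_rows_mul using D[of z] D0 by simp
    ultimately show False
      using tendsto_unique[OF trivial_limit_at_infinity tendsto_const] by fastforce
  qed
  then show ?thesis
    using poly_roots_finite[of D] by (simp add: mpoly_spectrum_def D)
qed

section \<open>Continuity of the matrix fraction off the spectrum\<close>

text \<open>Column j of the inverse solves A x = e_j. As quotients of determinants the entries
  depend continuously on \<open>A\<close>.\<close>

lemma matrix_inv_entry_cramer:
  fixes A :: "complex ^ 'p ^ 'p"
  assumes "det A \<noteq> 0"
  shows "matrix_inv A $ k $ j = det (\<chi> i l. if l = k then axis j 1 $ i else A $ i $ l) / det A"
proof -
  have "invertible A" using assms by (simp add: invertible_det_nz)
  then have "A ** matrix_inv A = mat 1"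
    unfolding matrix_inv_def invertible_def by (rule someI_ex[THEN conjunct1])
  then have "A *v column j (matrix_inv A) = axis j 1"
    by (simp add: vec_eq_iff matrix_vector_mult_def matrix_matrix_mult_def column_def mat_def axis_def)
  then show ?thesis
    using cramer[OF assms] by (simp add: column_def vec_eq_iff)
qed

lemma tendsto_matrix_inv:
  fixes M :: "'a \<Rightarrow> complex ^ 'p ^ 'p"
  assumes lim: "\<And>i j. ((\<lambda>z. M z $ i $ j) \<longlongrightarrow> L $ i $ j) F" and "det L \<noteq> 0"
  shows "((\<lambda>z. matrix_inv (M z) $ k $ j) \<longlongrightarrow> matrix_inv L $ k $ j) F"
proof -
  have "((\<lambda>z. det (\<chi> i l. if l = k then axis j 1 $ i else M z $ i $ l) / det (M z)) \<longlongrightarrow>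
      det (\<chi> i l. if l = k then axis j 1 $ i else L $ i $ l) / det L) F"
    using assms(2) by (intro tendsto_divide tendsto_det lim) (auto intro: lim)
  moreover have "\<forall>\<^sub>F z in F. det (M z) \<noteq> 0"
    using tendsto_imp_eventually_ne[OF tendsto_det[OF lim] assms(2)] .
  then have "\<forall>\<^sub>F z in F. det (\<chi> i l. if l = k then axis j 1 $ i else M z $ i $ l) / det (M z)
      = matrix_inv (M z) $ k $ j"
    by eventually_elim (simp add: matrix_inv_entry_cramer)
  ultimately show ?thesis
    unfolding matrix_inv_entry_cramer[OF assms(2)] by (rule Lim_transform_eventually)
qed

text \<open>The determinant stays nonzero near w, so the formula for \<open>R\<close> holds there
  and Cramer's rule gives continuity. These finite limits exclude poles outside \<sigma>(P).\<close>

lemma matrix_fraction_tendsto: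
  fixes R :: "complex \<Rightarrow> complex ^ 'p ^ 'p"
  assumes R: "\<And>z. z \<notin> mpoly_spectrum P \<Longrightarrow> R z = mpoly_eval Q z ** matrix_inv (mpoly_eval P z)"
    and w: "w \<notin> mpoly_spectrum P"
  shows "((\<lambda>z. R z $ i $ j) \<longlongrightarrow> R w $ i $ j) (at w)"
proof -
  have ev: "((\<lambda>z. mpoly_eval F z $ k $ l) \<longlongrightarrow> mpoly_eval F w $ k $ l) (at w)" for F k l
    unfolding poly_mpoly_entry[symmetric] by (intro tendsto_intros)
  have det: "det (mpoly_eval P w) \<noteq> 0" using w by (simp add: mpoly_spectrum_def)
  have "((\<lambda>z. (mpoly_eval Q z ** matrix_inv (mpoly_eval P z)) $ i $ j) \<longlongrightarrow>
      (mpoly_eval Q w ** matrix_inv (mpoly_eval P w)) $ i $ j) (at w)"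
    unfolding matrix_matrix_mult_def
    by (simp, intro tendsto_intros ev tendsto_matrix_inv det)
  moreover have "\<forall>\<^sub>F z in at w. det (mpoly_eval P z) \<noteq> 0"
    using tendsto_imp_eventually_ne[OF tendsto_det[OF ev] det] .
  then have "\<forall>\<^sub>F z in at w. (mpoly_eval Q z ** matrix_inv (mpoly_eval P z)) $ i $ j = R z $ i $ j"
    by eventually_elim (simp add: R mpoly_spectrum_def)
  ultimately show ?thesis
    unfolding R[OF w, symmetric] by (rule Lim_transform_eventually)
qed

section \<open>Poles of reduced fractions\<close>

lemma eventually_poly_nonzero:
  fixes d :: "complex poly"
  assumes "d \<noteq> 0"
  shows "\<forall>\<^sub>F z in at w. poly d z \<noteq> 0"
  using islimpt_finite[OF poly_roots_finite[OF assms], of w] by (simp add: islimpt_iff_eventually)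

text \<open>Since f d = n near w, a finite limit of f at a root of d would give n(w) = 0, against
  coprimality.\<close>

lemma denominator_nonzero_if_tendsto:
  fixes n d :: "complex poly"
  assumes "d \<noteq> 0" "coprime n d" and f: "\<And>z. poly d z \<noteq> 0 \<Longrightarrow> f z = poly n z / poly d z"
    and lim: "(f \<longlongrightarrow> l) (at w)"
  shows "poly d w \<noteq> 0"
proof
  assume d0: "poly d w = 0"
  have "((\<lambda>z. f z * poly d z) \<longlongrightarrow> l * poly d w) (at w)"
    by (intro tendsto_intros lim)
  moreover have "\<forall>\<^sub>F z in at w. f z * poly d z = poly n z"
    using eventually_poly_nonzero[OF assms(1)] by eventually_elim (simp add: f)
  ultimately have "(poly n \<longlongrightarrow> l * poly d w) (at w)"
    by (rule Lim_transform_eventually)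
  moreover have "(poly n \<longlongrightarrow> poly n w) (at w)"
    by (intro tendsto_intros)
  ultimately have "poly n w = 0"
    using tendsto_unique[OF at_neq_bot] d0 by fastforce
  then show False using coprime_poly_0[OF assms(2)] d0 by blast
qed

text \<open>The fraction has a finite limit at w. This leads from roots of denominators, which the
  argument controls, to \<open>entry_poles\<close>, in terms of which the symmetry of
  \<open>R\<close> is stated.\<close>

lemma not_is_pole_if_denominator_nonzero:
  fixes n d :: "complex poly"
  assumes f: "\<And>z. poly d z \<noteq> 0 \<Longrightarrow> f z = poly n z / poly d z" and w: "poly d w \<noteq> 0"
  shows "\<not> is_pole f w"
proof -
  have "((\<lambda>z. poly n z / poly d z) \<longlongrightarrow> poly n w / poly d w) (at w)"
    by (intro tendsto_intros w)
  moreover have "\<forall>\<^sub>F z in at w. poly n z / poly d z = f z"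
  proof -
    have "d \<noteq> 0" using w by auto
    from eventually_poly_nonzero[OF this] show ?thesis by eventually_elim (simp add: f)
  qed
  ultimately have "(f \<longlongrightarrow> poly n w / poly d w) (at w)"
    by (rule Lim_transform_eventually)
  then show ?thesis
    using not_tendsto_and_filterlim_at_infinity[OF at_neq_bot] by (auto simp: is_pole_def)
qed

theorem proposition2p2:
  fixes R :: "complex \<Rightarrow> complex ^ 'p ^ 'p"
    and Q P :: "(complex ^ 'p ^ 'p) poly"
  assumes "rational_matrix_fun R"
    and "self_adjoint_fun R"
    and "monic_mpoly P"
    and "degree P \<ge> 1"
    and "\<And>z. z \<notin> mpoly_spectrum P \<Longrightarrow> R z = mpoly_eval Q z ** matrix_inv (mpoly_eval P z)"
  shows "(herglotz_nevanlinna R \<longleftrightarrow>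
           (\<exists>A B r E \<mu>. has_herglotz_rep R A B r E \<mu> \<and> \<mu> ` {1..r} \<subseteq> mpoly_spectrum P \<inter> \<real>)) \<and>
         (herglotz_nevanlinna R \<longrightarrow> mpoly_spectrum P \<subseteq> \<real> \<longrightarrow>
           (\<exists>A B r E \<mu>. has_herglotz_rep R A B r E \<mu> \<and> bij_betw \<mu> {1..r} (mpoly_spectrum P)))"
proof -
  \<comment> \<open>A bijective enumeration of \<open>S\<close> serves both claims, as
    \<open>S\<close> is all of \<sigma>(P) when the spectrum is real.\<close>
  define S where "S = mpoly_spectrum P \<inter> \<real>"
  have rep: "\<exists>A B r E \<mu>. has_herglotz_rep R A B r E \<mu> \<and> bij_betw \<mu> {1..r} S"
    if hn: "herglotz_nevanlinna R"
  proof -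
    have "\<forall>i j. \<exists>n d. d \<noteq> 0 \<and> coprime n d \<and> (\<forall>z. poly d z \<noteq> 0 \<longrightarrow> R z $ i $ j = poly n z / poly d z)"
      using assms(1) by (simp add: rational_matrix_fun_def rational_fun_def)
    then obtain n d where d: "\<And>i j. d i j \<noteq> 0" and cop: "\<And>i j. coprime (n i j) (d i j)"
      and R: "\<And>i j z. poly (d i j) z \<noteq> 0 \<Longrightarrow> R z $ i $ j = poly (n i j) z / poly (d i j) z"
      unfolding choice_iff by blast
    note nonzero = denominator_nonzero_if_tendsto[OF d cop R]
    have no_pole: "z \<notin> entry_poles R" if "\<And>i j. poly (d i j) z \<noteq> 0" for z
      using not_is_pole_if_denominator_nonzero[OF R that] by (auto simp: entry_poles_def)
    have upper: "isCont (\<lambda>z. R z $ i $ j) w" if "Im w > 0" for w i j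
    proof -
      have "(\<lambda>z. R z $ i $ j) holomorphic_on {z. Im z > 0}"
        using hn by (simp add: herglotz_nevanlinna_def)
      then have "continuous_on {z. Im z > 0} (\<lambda>z. R z $ i $ j)"
        by (rule holomorphic_on_imp_continuous_on)
      then show ?thesis
        using that by (simp add: continuous_on_eq_continuous_at open_halfspace_Im_gt)
    qed
    \<comment> \<open>Reflection: \<open>R\<close> is continuous at \<open>cnj w\<close>, and the
      symmetry turns this into a finite limit at w.\<close>
    have lower: "poly (d i j) w \<noteq> 0" if w: "Im w < 0" for w i j
    proof (rule nonzero)
      have "isCont (\<lambda>z. R z $ j $ i) (cnj w)" using w by (intro upper) simp
      moreover have "isCont cnj w" by (intro continuous_intros)
      ultimately have "isCont (\<lambda>z. R (cnj z) $ j $ i) w"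
        by (rule isCont_o2[rotated])
      then have "isCont (\<lambda>z. cnj (R (cnj z) $ j $ i)) w"
        by (rule continuous_cnj)
      then have "((\<lambda>z. cnj (R (cnj z) $ j $ i)) \<longlongrightarrow> cnj (R (cnj w) $ j $ i)) (at w)"
        by (simp add: isCont_def)
      \<comment> \<open>The symmetry is available off the poles; the finitely many denominators have
        no root in a punctured neighbourhood of w.\<close>
      moreover have "\<forall>\<^sub>F z in at w. \<forall>k l. poly (d k l) z \<noteq> 0"
        by (simp add: eventually_all_finite eventually_poly_nonzero d)
      then have "\<forall>\<^sub>F z in at w. cnj (R (cnj z) $ j $ i) = R z $ i $ j"
      proof eventually_elim
        case (elim z)
        then have "R z = conj_transpose (R (cnj z))"
          using no_pole assms(2) by (simp add: self_adjoint_fun_def)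
        then show ?case by (metis (no_types, lifting) conj_transpose_def vec_lambda_beta)
      qed
      ultimately show "((\<lambda>z. R z $ i $ j) \<longlongrightarrow> cnj (R (cnj w) $ j $ i)) (at w)"
        by (rule Lim_transform_eventually)
    qed
    \<comment> \<open>Finite limits rule out the upper half plane, the lower half plane and the
      complement of \<sigma>(P), which leaves \<open>S\<close>.\<close>
    have roots: "z \<in> S" if "poly (d i j) z = 0" for i j z
    proof -
      have "\<not> Im z > 0" "\<not> Im z < 0"
        using that nonzero upper lower unfolding isCont_def by blast+
      moreover have "z \<in> mpoly_spectrum P"
        using that nonzero matrix_fraction_tendsto[OF assms(5)] by blast
      ultimately show ?thesis by (simp add: S_def complex_is_Real_iff)
    qed
    have "finite S" "S \<subseteq> \<real>" using finite_mpoly_spectrum[OF assms(3)] by (auto simp: S_def)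
    then obtain A B r E \<mu> where "has_herglotz_rep R A B r E \<mu>" "bij_betw \<mu> {1..r} S"
    proof (rule rational_nevanlinna_herglotz_rep[where R = R and n = n, OF _ _ d roots])
      show "R z $ i $ j = poly (n i j) z / poly (d i j) z" if "z \<notin> S" for i j z
        using that roots R by blast
      show "0 \<le> Im (qform (R z) x)" if "Im z > 0" for z x
        using hn that unfolding herglotz_nevanlinna_def psd_imaginary_part_iff by blast
      show "R z = conj_transpose (R (cnj z))" if "z \<notin> S" for z
        using that roots no_pole assms(2) unfolding self_adjoint_fun_def by blast
    qed
    then show ?thesis
      by (intro exI[of _ A] exI[of _ B] exI[of _ r] exI[of _ E] exI[of _ \<mu>] conjI)
  qed
  show ?thesis
  proof (intro conjI iffI impI)
    assume hn: "herglotz_nevanlinna R"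
    then show "\<exists>A B r E \<mu>. has_herglotz_rep R A B r E \<mu> \<and> \<mu> ` {1..r} \<subseteq> mpoly_spectrum P \<inter> \<real>"
      using rep by (auto simp: S_def bij_betw_def elim!: ex_forward)
    assume "mpoly_spectrum P \<subseteq> \<real>"
    then have "S = mpoly_spectrum P" by (auto simp: S_def)
    then show "\<exists>A B r E \<mu>. has_herglotz_rep R A B r E \<mu> \<and> bij_betw \<mu> {1..r} (mpoly_spectrum P)"
      using rep[OF hn] by simp
  next
    assume "\<exists>A B r E \<mu>. has_herglotz_rep R A B r E \<mu> \<and> \<mu> ` {1..r} \<subseteq> mpoly_spectrum P \<inter> \<real>"
    then show "herglotz_nevanlinna R"
      by (elim exE conjE) (rule herglotz_nevanlinna_if_rep, assumption, simp)
  qed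
qed

end
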